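(* Let $-D\le C<D\le 1$ and let $f(z)=z+\sum_{m=2}^{\infty}a_m z^m+\overline{\sum_{m=2}^{\infty}b_m z^m}\in\mathcal{S}^{*}_{\tau}(C,D)$. Then $$r-\frac{D-C}{1+2D-C}r^2\le|f(z)|\le r+\frac{D-C}{1+2D-C}r^2\qquad(|z|=r<1)$$ and $$|z|+\sum_{m=2}^\infty(|a_m|+|b_m|)|z|^m\le d(f(0),\partial f(\mathbb{D}))$$ for $|z|\le r^*$, where $$r^*=\frac{-1+\sqrt{1+4\left(\frac{D-C}{1+2D-C}\right)\left(1-\frac{D-C}{1+2D-C}\right)}}{2\left(\frac{D-C}{1+2D-C}\right)}.$$ The radius $r^*$ is the Bohr radius of the class (the largest radius for which the last inequality holds for all members of $\mathcal{S}^{*}_{\tau}(C,D)$), and it is achieved by the function $f(z)=z-\frac{D-C}{1+2D-C}z^2$.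
   Context: $\mathbb{D}=\{z\in\mathbb{C}:|z|<1\}$; $d(f(0),\partial f(\mathbb{D}))$ is the Euclidean distance from $f(0)$ to the boundary of $f(\mathbb{D})$. $\mathcal{H}_0$ is the class of complex-valued harmonic functions $f=h+\bar g$ on $\mathbb{D}$ with $h(z)=z+\sum_{m=2}^\infty a_mz^m$ and $g(z)=\sum_{m=2}^\infty b_mz^m$ analytic in $\mathbb{D}$. $\tau^0$ is the class of those $f\in\mathcal{H}_0$ with $a_m=-|a_m|$ and $b_m=|b_m|$ for all $m\ge2$. For $f\in\mathcal{H}_0$ put $\mathcal{D}_{\mathcal{H}}f(z)=zh'(z)-\overline{zg'(z)}$. For a function $q$ on $\mathbb{D}$ and a univalent analytic $\phi$ on $\mathbb{D}$, $q\prec\phi$ means $q(0)=\phi(0)$ and $q(\mathbb{D})\subseteq\phi(\mathbb{D})$. $\mathcal{S}^{*}_{\mathcal{H}}(C,D)$ is the class of $f\in\mathcal{H}_0$ such that $\frac{\mathcal{D}_{\mathcal{H}}f(z)}{f(z)}\prec\frac{1+Cz}{1+Dz}$ (the quotient being well defined on $\mathbb{D}\setminus\{0\}$ and taken to be $1$ at $z=0$), and $\mathcal{S}^{*}_\tau(C,D)=\tau^0\cap\mathcal{S}^{*}_{\mathcal{H}}(C,D)$. *)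

theory Defs
  imports "HOL-Complex_Analysis.Complex_Analysis"
begin

abbreviation unit_disc :: "complex set"  ("\<D>")
  where "\<D> \<equiv> ball 0 1"

text \<open>The decomposition f = h + conj g of a member of the class H0, together with the power series
  h z = z + a 2 * z^2 + ... and g z = b 2 * z^2 + ... on the unit disc. Since g 0 = 0, the values of
  h and g on the disc and the coefficients a m, b m for m >= 2 are determined by f; the entries of
  a and b at 0 and 1 are irrelevant.\<close>

definition H0_rep ::
  "(complex \<Rightarrow> complex) \<Rightarrow> (complex \<Rightarrow> complex) \<Rightarrow> (complex \<Rightarrow> complex) \<Rightarrow>
   (nat \<Rightarrow> complex) \<Rightarrow> (nat \<Rightarrow> complex) \<Rightarrow> bool" where
  "H0_rep f h g a b \<longleftrightarrow>
     h holomorphic_on \<D> \<and> g holomorphic_on \<D> \<and>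
     (\<forall>z\<in>\<D>. f z = h z + cnj (g z)) \<and>
     (\<forall>z\<in>\<D>. (\<lambda>m. a (m + 2) * z ^ (m + 2)) sums (h z - z)) \<and>
     (\<forall>z\<in>\<D>. (\<lambda>m. b (m + 2) * z ^ (m + 2)) sums g z)"

definition H0 :: "(complex \<Rightarrow> complex) set" where
  "H0 = {f. \<exists>h g a b. H0_rep f h g a b}"

definition tau0 :: "(complex \<Rightarrow> complex) set" where
  "tau0 = {f. \<exists>h g a b. H0_rep f h g a b \<and>
     (\<forall>m\<ge>2. a m = - of_real (cmod (a m)) \<and> b m = of_real (cmod (b m)))}"

definition D_H :: "(complex \<Rightarrow> complex) \<Rightarrow> (complex \<Rightarrow> complex) \<Rightarrow> complex \<Rightarrow> complex" where
  "D_H h g z = z * deriv h z - cnj (z * deriv g z)"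

text \<open>Subordination to a univalent analytic function \<open>\<phi>\<close>; univalence is not part of the definition,
  it holds for the Moebius map below whenever -1 <= D <= 1 and C differs from D.\<close>

definition subordinate :: "(complex \<Rightarrow> complex) \<Rightarrow> (complex \<Rightarrow> complex) \<Rightarrow> bool"
    (infix "\<prec>\<^sub>D" 50) where
  "q \<prec>\<^sub>D \<phi> \<longleftrightarrow> q 0 = \<phi> 0 \<and> q ` \<D> \<subseteq> \<phi> ` \<D>"

text \<open>The condition that f has no zero in the punctured disc makes the quotient well defined
  (division by zero is total in HOL).\<close>

definition Sstar_H :: "real \<Rightarrow> real \<Rightarrow> (complex \<Rightarrow> complex) set" where
  "Sstar_H C D = {f. \<exists>h g a b. H0_rep f h g a b \<and>
     (\<forall>z\<in>\<D> - {0}. f z \<noteq> 0) \<and>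
     (\<lambda>z. if z = 0 then 1 else D_H h g z / f z)
       \<prec>\<^sub>D (\<lambda>z. (1 + of_real C * z) / (1 + of_real D * z))}"

definition Sstar_tau :: "real \<Rightarrow> real \<Rightarrow> (complex \<Rightarrow> complex) set" where
  "Sstar_tau C D = tau0 \<inter> Sstar_H C D"

definition Bohr_sum :: "(nat \<Rightarrow> complex) \<Rightarrow> (nat \<Rightarrow> complex) \<Rightarrow> complex \<Rightarrow> real" where
  "Bohr_sum a b z =
     cmod z + (\<Sum>m. (cmod (a (m + 2)) + cmod (b (m + 2))) * cmod z ^ (m + 2))"

definition boundary_dist :: "(complex \<Rightarrow> complex) \<Rightarrow> real" where
  "boundary_dist f = infdist (f 0) (frontier (f ` \<D>))"

definition Bohr_radii :: "(complex \<Rightarrow> complex) set \<Rightarrow> real set" where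
  "Bohr_radii F = {R. 0 \<le> R \<and> R \<le> 1 \<and>
     (\<forall>f\<in>F. \<forall>h g a b. H0_rep f h g a b \<longrightarrow>
        (\<forall>z\<in>\<D>. cmod z \<le> R \<longrightarrow> Bohr_sum a b z \<le> boundary_dist f))}"

definition is_Bohr_radius :: "(complex \<Rightarrow> complex) set \<Rightarrow> real \<Rightarrow> bool" where
  "is_Bohr_radius F R \<longleftrightarrow> R \<in> Bohr_radii F \<and> (\<forall>R'\<in>Bohr_radii F. R' \<le> R)"

end

theory Submission
  imports Defs
begin

text \<open>Along the positive radius the subordination turns into the coefficient inequality
  \<open>\<Sum> [(m(1+D) - (1+C)) |a_m| + (m(1+D) + (1+C)) |b_m|] \<le> D - C\<close>. Since the weights are at least
  \<open>1 + 2D - C\<close> for \<open>m \<ge> 2\<close>, the sum of all \<open>|a_m| + |b_m|\<close> is at most \<open>k\<close>, which gives the growth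
  estimates. Since the weights are also at least \<open>m(D - C)\<close>, the sum of all \<open>m(|a_m| + |b_m|)\<close> is at
  most 1, so \<open>f\<close> is injective, hence open by invariance of domain. Boundary points of the image are
  therefore limits of \<open>f\<close> at the unit circle and have modulus at least \<open>1 - k\<close>. The Bohr sum is at
  most \<open>r + k r^2\<close>, and \<open>rstar\<close> is the positive root of \<open>r + k r^2 = 1 - k\<close>.\<close>

section \<open>Uniqueness of the decomposition and of its coefficients\<close>

lemma holomorphic_eq_cnj_holomorphic_imp_constant:
  assumes "open S" "convex S" and u: "u holomorphic_on S" and v: "v holomorphic_on S"
    and eq: "\<And>z. z \<in> S \<Longrightarrow> u z = cnj (v z)"
  shows "\<exists>c. \<forall>z\<in>S. u z = c"
proof (rule has_field_derivative_zero_constant[OF \<open>convex S\<close>])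
  fix z assume z: "z \<in> S"
  have du: "(u has_field_derivative deriv u z) (at z)"
    and dv: "(v has_field_derivative deriv v z) (at z)"
    using u v z \<open>open S\<close> by (auto intro: holomorphic_derivI)
  have "((\<lambda>w. cnj (v w)) has_derivative (\<lambda>x. cnj (deriv v z * x))) (at z)"
    using dv[unfolded has_field_derivative_def] by (rule has_derivative_cnj)
  then have "(u has_derivative (\<lambda>x. cnj (deriv v z * x))) (at z)"
    by (rule has_derivative_transform_within_open[OF _ \<open>open S\<close> z]) (simp add: eq)
  then have *: "(*) (deriv u z) = (\<lambda>x. cnj (deriv v z * x))"
    using du[unfolded has_field_derivative_def] has_derivative_unique by blast
  \<comment> \<open>The derivative is both complex linear and conjugate linear. Testing at 1 and at
    the imaginary unit gives \<open>deriv u z\<close> two values of opposite sign.\<close>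
  have "deriv u z = 0"
    using fun_cong[OF *, of 1] fun_cong[OF *, of \<i>] by (auto simp: complex_eq_iff)
  then show "(u has_field_derivative 0) (at z within S)"
    using du has_field_derivative_at_within by metis
qed

text \<open>The entries at 0 and 1 are arbitrary in \<open>H0_rep\<close>. Replacing them by 0
  yields an ordinary power series, to which the general results on such series apply.\<close>

lemma shifted_powser_sums_iff:
  fixes a :: "nat \<Rightarrow> complex"
  shows "(\<lambda>m. a (m + 2) * z ^ (m + 2)) sums s \<longleftrightarrow>
    (\<lambda>n. (if n < 2 then 0 else a n) * z ^ n) sums s"
  using sums_iff_shift[of "\<lambda>n. (if n < 2 then 0 else a n) * z ^ n" 2 s]
  by (simp add: numeral_2_eq_2)

lemma shifted_powser_unique:
  fixes a b :: "nat \<Rightarrow> complex"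
  assumes a: "\<And>z. z \<in> \<D> \<Longrightarrow> (\<lambda>m. a (m + 2) * z ^ (m + 2)) sums H z"
    and b: "\<And>z. z \<in> \<D> \<Longrightarrow> (\<lambda>m. b (m + 2) * z ^ (m + 2)) sums H z"
    and n: "n \<ge> 2"
  shows "a n = b n"
proof (rule ccontr)
  assume ne: "a n \<noteq> b n"
  have s: "(\<lambda>n. (if n < 2 then 0 else a n - b n) * (z - 0) ^ n) sums 0" if "norm (z - 0) < 1" for z
    using sums_diff[OF a[of z] b[of z]] that shifted_powser_sums_iff[of "\<lambda>n. a n - b n" z 0]
    by (simp add: algebra_simps)
  \<comment> \<open>A nonzero coefficient would keep the sum of the difference series away from 0 on
    a punctured disc; that sum is the zero function.\<close>
  obtain s where "0 < s" "\<And>z::complex. z \<in> cball 0 s - {0} \<Longrightarrow> (0::complex) \<noteq> 0"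
    by (rule powser_0_nonzero[OF zero_less_one s, of n]) (use n ne in auto)
  from this(2)[of "of_real s"] \<open>0 < s\<close> show False by auto
qed

lemma H0_rep_at_0:
  assumes "H0_rep f h g a b"
  shows "h 0 = 0" "g 0 = 0" "f 0 = 0"
proof -
  have "(\<lambda>m. a (m + 2) * 0 ^ (m + 2)) sums (h 0 - 0)" "(\<lambda>m. b (m + 2) * 0 ^ (m + 2)) sums g 0"
    and f: "f 0 = h 0 + cnj (g 0)"
    using assms[unfolded H0_rep_def] centre_in_ball[of "0::complex" 1] zero_less_one by blast+
  then have "(\<lambda>m. 0) sums (h 0 - 0)" "(\<lambda>m. 0) sums g 0"
    by simp_all
  then show "h 0 = 0" "g 0 = 0"
    using sums_unique2[OF sums_zero] by fastforce+
  with f show "f 0 = 0" by simp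
qed

text \<open>Two decompositions give \<open>h - h' = cnj (g' - g)\<close>, which is holomorphic and
  antiholomorphic, hence constant, and it vanishes at 0. This lets properties obtained from
  different existential witnesses be moved to one pair of coefficient sequences.\<close>

lemma H0_rep_unique:
  assumes 1: "H0_rep f h g a b" and 2: "H0_rep f h' g' a' b'" and n: "n \<ge> 2"
  shows "a n = a' n" "b n = b' n"
proof -
  have "\<exists>c. \<forall>z\<in>\<D>. h z - h' z = c"
    by (rule holomorphic_eq_cnj_holomorphic_imp_constant[where v = "\<lambda>z. g' z - g z"])
      (use 1 2 in \<open>auto simp: H0_rep_def algebra_simps intro!: holomorphic_intros\<close>)
  then obtain c where c: "\<And>z. z \<in> \<D> \<Longrightarrow> h z - h' z = c" by blast
  then have "c = 0"
    using c[of 0] H0_rep_at_0[OF 1] H0_rep_at_0[OF 2] by simp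
  then have h: "h z = h' z" if "z \<in> \<D>" for z
    using c that by fastforce
  have g: "g z = g' z" if "z \<in> \<D>" for z
  proof -
    have "h z + cnj (g z) = h' z + cnj (g' z)"
      using that 1 2 by (auto simp: H0_rep_def)
    then show ?thesis using h[OF that] by simp
  qed
  show "a n = a' n"
    by (rule shifted_powser_unique[where H = "\<lambda>z. h z - z", OF _ _ n])
      (use 1 2 h in \<open>auto simp: H0_rep_def\<close>)
  show "b n = b' n"
    by (rule shifted_powser_unique[where H = g, OF _ _ n])
      (use 1 2 g in \<open>auto simp: H0_rep_def\<close>)
qed

section \<open>From the subordination to the coefficient bounds\<close>

lemma shifted_powser_deriv_sums:
  fixes a :: "nat \<Rightarrow> complex"
  assumes a: "\<And>z. z \<in> \<D> \<Longrightarrow> (\<lambda>m. a (m + 2) * z ^ (m + 2)) sums H z"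
    and d: "(H has_field_derivative H') (at z)" and z: "z \<in> \<D>"
  shows "(\<lambda>m. of_nat (m + 2) * a (m + 2) * z ^ (m + 2)) sums (z * H')"
proof -
  define c where "c n = (if n < 2 then 0 else a n)" for n
  have "(\<lambda>n. diffs c n * z ^ n) sums H'"
    by (rule termdiffs_sums_strong[where K = 1 and f = H])
      (use a d z shifted_powser_sums_iff in \<open>auto simp: c_def\<close>)
  then have "(\<lambda>n. z * (diffs c n * z ^ n)) sums (z * H')"
    by (rule sums_mult)
  then have "(\<lambda>n. of_nat (Suc n) * c (Suc n) * z ^ Suc n) sums (z * H')"
    by (simp add: diffs_def algebra_simps)
  \<comment> \<open>The factor \<open>z\<close> undoes the exponent shift of \<open>diffs\<close>,
    and the term at index 0 vanishes, so reindexing leaves the sum unchanged.\<close>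
  then have "(\<lambda>n. of_nat n * c n * z ^ n) sums (z * H')"
    by (subst (asm) sums_Suc_iff) (simp add: c_def)
  moreover have "(\<lambda>n. of_nat n * c n * z ^ n) = (\<lambda>n. (if n < 2 then 0 else of_nat n * a n) * z ^ n)"
    by (auto simp: c_def)
  ultimately show ?thesis
    using shifted_powser_sums_iff[of "\<lambda>n. of_nat n * a n"] by simp
qed

text \<open>The image is a disc (a half-plane if \<open>D = 1\<close>) symmetric about the real
  axis, and its leftmost boundary point is the value at 1.\<close>

lemma Re_Moebius_gt:
  fixes C D :: real and \<zeta> :: complex
  assumes "0 < D" "D \<le> 1" "C < D" "cmod \<zeta> < 1"
  shows "(1 + C) / (1 + D) < Re ((1 + of_real C * \<zeta>) / (1 + of_real D * \<zeta>))"
proof -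
  define x y where "x = Re \<zeta>" and "y = Im \<zeta>"
  have xy: "x\<^sup>2 + y\<^sup>2 < 1"
    using assms(4) unfolding cmod_def x_def y_def by simp
  have x1: "x < 1"
    using abs_Re_le_cmod[of \<zeta>] assms(4) by (auto simp: x_def)
  define N where "N = (1 + D * x)\<^sup>2 + (D * y)\<^sup>2"
  have "- x < 1" using abs_Re_le_cmod[of \<zeta>] assms(4) by (auto simp: x_def)
  then have "D * (- x) < 1"
    using assms mult_strict_left_mono[of "- x" 1 D] by linarith
  then have N: "N > 0"
    unfolding N_def by (intro add_pos_nonneg) auto
  have "0 < D * (1 - D) * (1 - x) + D\<^sup>2 * (1 - (x\<^sup>2 + y\<^sup>2))"
    using assms x1 xy by (intro add_nonneg_pos mult_nonneg_nonneg mult_pos_pos) auto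
  also have "\<dots> = (1 + D) * (1 + D * x) - N"
    by (simp add: N_def algebra_simps power2_eq_square)
  finally have *: "N < (1 + D) * (1 + D * x)" by simp
  have "Re ((1 + of_real C * \<zeta>) / (1 + of_real D * \<zeta>)) =
      ((1 + C * x) * (1 + D * x) + (C * y) * (D * y)) / N"
    by (simp add: Re_divide N_def x_def y_def)
  moreover have "(1 + C) * N < (1 + D) * ((1 + C * x) * (1 + D * x) + (C * y) * (D * y))"
  proof -
    \<comment> \<open>The Moebius map equals \<open>C/D + (1 - C/D) / (1 + D * \<zeta>)\<close>, so
      the claim reduces to \<open>*\<close>, that is, to the bound \<open>1 / (1 + D)\<close> for
      the real part of \<open>1 / (1 + D * \<zeta>)\<close>.\<close>
    have "0 < (D - C) * ((1 + D) * (1 + D * x) - N)"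
      using * assms by simp
    also have "\<dots> = D * ((1 + D) * ((1 + C * x) * (1 + D * x) + (C * y) * (D * y)) - (1 + C) * N)"
      by (simp add: N_def algebra_simps power2_eq_square)
    finally show ?thesis
      using assms by (simp add: zero_less_mult_iff)
  qed
  moreover have "(1 + C) / (1 + D) < X / N" if "(1 + C) * N < (1 + D) * X" for X
    using N assms that by (simp add: field_simps)
  ultimately show ?thesis by simp
qed

text \<open>On the positive radius, \<open>f\<close> and \<open>D_H f\<close> are real, and \<open>f\<close> is positive because it has
  derivative 1 at the origin and no zero. There the subordination gives
  \<open>(1 + C) f(r) < (1 + D) D_H f(r)\<close>, an inequality between power series with coefficients of one
  sign, in which \<open>r\<close> tends to 1.\<close>

lemma Sstar_coeff_partial_sum:
  fixes C D :: real
  assumes rep: "H0_rep f h g a b"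
    and sgn: "\<And>m. m \<ge> 2 \<Longrightarrow> a m = - of_real (cmod (a m)) \<and> b m = of_real (cmod (b m))"
    and nz: "\<And>z. z \<in> \<D> - {0} \<Longrightarrow> f z \<noteq> 0"
    and sub: "(\<lambda>z. if z = 0 then 1 else D_H h g z / f z)
       \<prec>\<^sub>D (\<lambda>z. (1 + of_real C * z) / (1 + of_real D * z))"
    and CD: "0 < D" "D \<le> 1" "C < D" "-1 \<le> C"
  shows "(\<Sum>m<N. (real (m + 2) * (1 + D) - (1 + C)) * cmod (a (m + 2))
     + (real (m + 2) * (1 + D) + (1 + C)) * cmod (b (m + 2))) \<le> D - C"
proof -
  define A B where "A m = cmod (a (m + 2))" and "B m = cmod (b (m + 2))" for m
  define e where "e m = (real (m + 2) * (1 + D) - (1 + C)) * A m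
     + (real (m + 2) * (1 + D) + (1 + C)) * B m" for m
  have a: "a (m + 2) = of_real (- A m)" and b: "b (m + 2) = of_real (B m)" for m
    using sgn[of "m + 2"] by (auto simp: A_def B_def)
  have hol: "h holomorphic_on \<D>" "g holomorphic_on \<D>"
    and f: "\<And>z. z \<in> \<D> \<Longrightarrow> f z = h z + cnj (g z)"
    and hs: "\<And>z. z \<in> \<D> \<Longrightarrow> (\<lambda>m. a (m + 2) * z ^ (m + 2)) sums (h z - z)"
    and gs: "\<And>z. z \<in> \<D> \<Longrightarrow> (\<lambda>m. b (m + 2) * z ^ (m + 2)) sums g z"
    using rep by (auto simp: H0_rep_def)
  have e0: "0 \<le> e m" for m
  proof -
    have "1 * (1 + C) \<le> real (m + 2) * (1 + D)"
      using CD by (intro mult_mono) auto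
    moreover have "0 \<le> A m" "0 \<le> B m" "0 \<le> real (m + 2) * (1 + D) + (1 + C)"
      using CD by (auto simp: A_def B_def)
    ultimately show ?thesis
      unfolding e_def by simp
  qed
  have real_series: "x sums Re s \<and> Im s = 0" if "(\<lambda>m. of_real (x m)) sums s" for x and s :: complex
    using that sums_unique2[OF sums_zero, of "Im s"] by (auto simp: sums_complex_iff)
  have in_D: "complex_of_real r \<in> \<D>" if "0 \<le> r" "r < 1" for r
    using that by simp
  have dh: "(h has_field_derivative deriv h z) (at z)" and dg: "(g has_field_derivative deriv g z) (at z)"
    if "z \<in> \<D>" for z
    using hol that by (auto intro: holomorphic_derivI)
  have h_real: "(\<lambda>m. - A m * r ^ (m + 2)) sums (Re (h r) - r) \<and> Im (h r) = 0"
    and g_real: "(\<lambda>m. B m * r ^ (m + 2)) sums Re (g r) \<and> Im (g r) = 0"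
    and dh_real: "(\<lambda>m. - real (m + 2) * A m * r ^ (m + 2)) sums (Re (r * deriv h r) - r) \<and> Im (r * deriv h r) = 0"
    and dg_real: "(\<lambda>m. real (m + 2) * B m * r ^ (m + 2)) sums (Re (r * deriv g r)) \<and> Im (r * deriv g r) = 0"
    if r: "0 \<le> r" "r < 1" for r :: real
  proof -
    have "(\<lambda>m. of_real (- A m * r ^ (m + 2))) sums (h r - r)"
      using hs[OF in_D[OF r]] unfolding a by simp
    from real_series[OF this]
    show "(\<lambda>m. - A m * r ^ (m + 2)) sums (Re (h r) - r) \<and> Im (h r) = 0" by simp
    have "(\<lambda>m. of_real (B m * r ^ (m + 2))) sums (g r)"
      using gs[OF in_D[OF r]] unfolding b by simp
    from real_series[OF this]
    show "(\<lambda>m. B m * r ^ (m + 2)) sums Re (g r) \<and> Im (g r) = 0" by simp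
    have "((\<lambda>z. h z - z) has_field_derivative deriv h r - 1) (at (of_real r))"
      using dh[OF in_D[OF r]] by (intro derivative_intros)
    from shifted_powser_deriv_sums[OF hs this in_D[OF r]]
    have "(\<lambda>m. of_real (- real (m + 2) * A m * r ^ (m + 2))) sums (r * deriv h r - r)"
      unfolding a by (simp add: algebra_simps)
    from real_series[OF this]
    show "(\<lambda>m. - real (m + 2) * A m * r ^ (m + 2)) sums (Re (r * deriv h r) - r) \<and> Im (r * deriv h r) = 0"
      by simp
    from shifted_powser_deriv_sums[OF gs dg[OF in_D[OF r]] in_D[OF r]]
    have "(\<lambda>m. of_real (real (m + 2) * B m * r ^ (m + 2))) sums (r * deriv g r)"
      unfolding b by simp
    from real_series[OF this]
    show "(\<lambda>m. real (m + 2) * B m * r ^ (m + 2)) sums (Re (r * deriv g r)) \<and> Im (r * deriv g r) = 0"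
      by simp
  qed
  define p where "p r = Re (h (of_real r)) + Re (g (of_real r))" for r :: real
  have fp: "f r = of_real (p r)" if "0 \<le> r" "r < 1" for r :: real
    using f[OF in_D[OF that]] h_real[OF that] g_real[OF that] by (simp add: p_def complex_eq_iff)
  have pne: "p r \<noteq> 0" if "0 < r" "r < 1" for r
    using nz[of "of_real r"] fp[of r] that by auto
  have derivs_0: "deriv h 0 = 1" "deriv g 0 = 0"
  proof -
    \<comment> \<open>At the origin only the constant term of the differentiated series survives; it
      is the zero entry put in at index 1.\<close>
    have *: "(\<lambda>n. diffs c n * 0 ^ n) sums F' \<longleftrightarrow> F' = c 1" for c :: "nat \<Rightarrow> complex" and F'
      by (auto simp: diffs_def)
    have "(\<lambda>n. diffs (\<lambda>n. if n < 2 then 0 else a n) n * 0 ^ n) sums (deriv h 0 - 1)"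
      by (rule termdiffs_sums_strong[where K = 1 and f = "\<lambda>z. h z - z"])
        (use hs shifted_powser_sums_iff[of a] dh[of 0] in \<open>auto intro!: derivative_intros\<close>)
    then show "deriv h 0 = 1" unfolding * by simp
    have "(\<lambda>n. diffs (\<lambda>n. if n < 2 then 0 else b n) n * 0 ^ n) sums deriv g 0"
      by (rule termdiffs_sums_strong[where K = 1 and f = g])
        (use gs shifted_powser_sums_iff[of b] dg[of 0] in \<open>auto intro!: derivative_intros\<close>)
    then show "deriv g 0 = 0" unfolding * by simp
  qed
  have "(p has_real_derivative 1) (at 0)"
  proof -
    have "((\<lambda>z. h z + g z) has_field_derivative 1) (at (of_real 0))"
      using dh[of 0] dg[of 0] derivs_0 by (auto intro!: derivative_eq_intros)
    from has_field_derivative_Re[OF field_vector_diff_chain_at[OF has_vector_derivative_of_real[OF DERIV_ident] this]]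
    show ?thesis unfolding p_def by (simp add: o_def)
  qed
  then obtain d where d: "d > 0" "\<And>x. 0 < x \<Longrightarrow> x < d \<Longrightarrow> p 0 < p x"
    using DERIV_pos_inc_right[of p 1 0] by auto
  have p0: "p 0 = 0"
    using H0_rep_at_0[OF rep] by (simp add: p_def)
  have ppos: "p r > 0" if r: "0 < r" "r < 1" for r
  proof (rule ccontr)
    assume "\<not> p r > 0"
    define s where "s = min r (d / 2)"
    have s: "0 < s" "s \<le> r" "s < d" "s < 1" using d r by (auto simp: s_def)
    have "continuous_on {s..r} p"
      unfolding p_def using s r
      by (intro continuous_intros continuous_on_compose2[OF holomorphic_on_imp_continuous_on[OF hol(1)]]
            continuous_on_compose2[OF holomorphic_on_imp_continuous_on[OF hol(2)]]) auto
    then obtain x where "s \<le> x" "x \<le> r" "p x = 0"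
      using IVT2'[of p r 0 s] \<open>\<not> p r > 0\<close> d(2)[of s] s p0 by force
    then show False using pne[of x] s r by auto
  qed
  have main: "(\<Sum>m<N. e m * r ^ (m + 2)) \<le> (D - C) * r" if r: "0 < r" "r < 1" for r
  proof -
    have r': "0 \<le> r" using r by simp
    define q where "q = Re (r * deriv h r) - Re (r * deriv g r)"
    have q: "D_H h g r = of_real q"
      using dh_real[OF r' r(2)] dg_real[OF r' r(2)] unfolding D_H_def q_def
      by (auto intro!: complex_eqI simp del: times_complex.sel complex_cnj_mult)
    have "(\<lambda>z. if z = 0 then 1 else D_H h g z / f z) (of_real r) \<in>
       (\<lambda>z. (1 + of_real C * z) / (1 + of_real D * z)) ` \<D>"
      using sub in_D[OF r' r(2)] unfolding subordinate_def by blast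
    then obtain \<zeta> where \<zeta>: "cmod \<zeta> < 1" "of_real (q / p r) = (1 + of_real C * \<zeta>) / (1 + of_real D * \<zeta>)"
      using r by (auto simp: q fp[OF r' r(2)])
    have "(1 + C) / (1 + D) < Re (of_real (q / p r))"
      unfolding \<zeta>(2) using Re_Moebius_gt[OF CD(1-3) \<zeta>(1)] .
    then have lt: "(1 + C) * p r < (1 + D) * q"
      using ppos[OF r] CD by (simp add: field_simps)
    \<comment> \<open>The four series are combined so that \<open>p\<close> and \<open>q\<close>
      appear as in \<open>lt\<close>. The linear terms \<open>r\<close>, subtracted from
      \<open>h\<close> and from its derivative series, leave \<open>(D - C) * r\<close>.\<close>
    have "(\<lambda>m. (1 + C) * (- A m * r ^ (m + 2)) + (1 + C) * (B m * r ^ (m + 2))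
         - (1 + D) * (- real (m + 2) * A m * r ^ (m + 2)) + (1 + D) * (real (m + 2) * B m * r ^ (m + 2)))
        sums ((1 + C) * (Re (h r) - r) + (1 + C) * Re (g r) - (1 + D) * (Re (r * deriv h r) - r)
           + (1 + D) * Re (r * deriv g r))"
      using h_real[OF r' r(2)] g_real[OF r' r(2)] dh_real[OF r' r(2)] dg_real[OF r' r(2)]
      by (intro sums_add sums_diff sums_mult) auto
    also have "(\<lambda>m. (1 + C) * (- A m * r ^ (m + 2)) + (1 + C) * (B m * r ^ (m + 2))
         - (1 + D) * (- real (m + 2) * A m * r ^ (m + 2)) + (1 + D) * (real (m + 2) * B m * r ^ (m + 2)))
       = (\<lambda>m. e m * r ^ (m + 2))"
      by (simp add: e_def algebra_simps)
    also have "(1 + C) * (Re (h r) - r) + (1 + C) * Re (g r) - (1 + D) * (Re (r * deriv h r) - r)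
           + (1 + D) * Re (r * deriv g r) = (1 + C) * p r - (1 + D) * q + (D - C) * r"
      by (simp add: p_def q_def algebra_simps)
    finally have es: "(\<lambda>m. e m * r ^ (m + 2)) sums ((1 + C) * p r - (1 + D) * q + (D - C) * r)" .
    have "(\<Sum>m<N. e m * r ^ (m + 2)) \<le> (\<Sum>m. e m * r ^ (m + 2))"
      using es e0 r by (intro sum_le_suminf) (auto simp: sums_iff)
    also have "\<dots> \<le> (D - C) * r"
      using es lt by (simp add: sums_iff)
    finally show ?thesis .
  qed
  \<comment> \<open>A partial sum is a polynomial in \<open>r\<close>, so the limit at 1 needs no
    convergence of the series there.\<close>
  have "(\<Sum>m<N. e m * 1 ^ (m + 2)) \<le> (D - C) * 1"
  proof (rule tendsto_le)
    show "((\<lambda>r. \<Sum>m<N. e m * r ^ (m + 2)) \<longlongrightarrow> (\<Sum>m<N. e m * 1 ^ (m + 2))) (at_left 1)"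
      by (intro tendsto_intros)
    show "((\<lambda>r. (D - C) * r) \<longlongrightarrow> (D - C) * 1) (at_left 1)"
      by (intro tendsto_intros)
    show "\<forall>\<^sub>F r in at_left 1. (\<Sum>m<N. e m * r ^ (m + 2)) \<le> (D - C) * r"
      using eventually_at_left_real[OF zero_less_one] by eventually_elim (use main in auto)
  qed simp
  then show ?thesis by (simp add: e_def A_def B_def)
qed

text \<open>The subordination and the signs come with two different decompositions. Uniqueness
  brings both to the given one, and then the weights \<open>e\<close> are compared with multiples of
  \<open>c\<close>.\<close>

lemma Sstar_tau_coeff_bounds:
  fixes C D :: real
  assumes f: "f \<in> Sstar_tau C D" and rep: "H0_rep f h g a b"
    and CD: "- D \<le> C" "C < D" "D \<le> 1"
  defines "c \<equiv> \<lambda>m. cmod (a (m + 2)) + cmod (b (m + 2))"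
  shows "summable c" "suminf c \<le> (D - C) / (1 + 2 * D - C)"
    and "summable (\<lambda>m. real (m + 2) * c m)" "(\<Sum>m. real (m + 2) * c m) \<le> 1"
proof -
  have D: "0 < D" "-1 \<le> C" using CD by auto
  obtain h1 g1 a1 b1 where rep1: "H0_rep f h1 g1 a1 b1"
    and nz: "\<And>z. z \<in> \<D> - {0} \<Longrightarrow> f z \<noteq> 0"
    and sub: "(\<lambda>z. if z = 0 then 1 else D_H h1 g1 z / f z)
       \<prec>\<^sub>D (\<lambda>z. (1 + of_real C * z) / (1 + of_real D * z))"
    using f by (auto simp: Sstar_tau_def Sstar_H_def)
  obtain h2 g2 a2 b2 where rep2: "H0_rep f h2 g2 a2 b2"
    and sgn2: "\<And>m. m \<ge> 2 \<Longrightarrow> a2 m = - of_real (cmod (a2 m)) \<and> b2 m = of_real (cmod (b2 m))"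
    using f by (auto simp: Sstar_tau_def tau0_def)
  have sgn: "a1 m = - of_real (cmod (a1 m)) \<and> b1 m = of_real (cmod (b1 m))" if "m \<ge> 2" for m
    using sgn2[OF that] H0_rep_unique[OF rep1 rep2 that] by simp
  define e where "e m = (real (m + 2) * (1 + D) - (1 + C)) * cmod (a (m + 2))
     + (real (m + 2) * (1 + D) + (1 + C)) * cmod (b (m + 2))" for m
  have e: "(\<Sum>m<N. e m) \<le> D - C" for N
    using Sstar_coeff_partial_sum[OF rep1 sgn nz sub D(1) CD(3,2) D(2), of N]
      H0_rep_unique[OF rep1 rep] by (simp add: e_def)
  have c0: "0 \<le> c m" for m by (simp add: c_def)
  \<comment> \<open>Since \<open>C\<close> is at least -1, the weight of \<open>a\<close> is the
    smaller of the two.\<close>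
  have bound: "t * c m \<le> e m" if "t \<le> real (m + 2) * (1 + D) - (1 + C)" for t m
  proof -
    have "t * cmod (a (m + 2)) \<le> (real (m + 2) * (1 + D) - (1 + C)) * cmod (a (m + 2))"
      "t * cmod (b (m + 2)) \<le> (real (m + 2) * (1 + D) + (1 + C)) * cmod (b (m + 2))"
      using that D by (intro mult_right_mono; simp)+
    then show ?thesis by (simp add: c_def e_def distrib_left)
  qed
  \<comment> \<open>The constant is the weight of the coefficient \<open>a 2\<close>.\<close>
  have c1: "(1 + 2 * D - C) * c m \<le> e m" for m
  proof (rule bound)
    have "2 * (1 + D) \<le> real (m + 2) * (1 + D)" using D by (intro mult_right_mono) auto
    then show "1 + 2 * D - C \<le> real (m + 2) * (1 + D) - (1 + C)" by simp
  qed
  \<comment> \<open>With \<open>n = m + 2\<close>, the weight of \<open>a\<close> exceeds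
    \<open>n * (D - C)\<close> by \<open>(n - 1) * (1 + C)\<close>.\<close>
  have c2: "(D - C) * (real (m + 2) * c m) \<le> e m" for m
  proof -
    have "1 * (1 + C) \<le> real (m + 2) * (1 + C)" using D by (intro mult_right_mono) auto
    then have "(D - C) * real (m + 2) \<le> real (m + 2) * (1 + D) - (1 + C)"
      by (simp add: algebra_simps)
    from bound[OF this] show ?thesis by (simp add: mult.assoc)
  qed
  have pos: "0 < 1 + 2 * D - C" using CD D by linarith
  have *: "summable x \<and> suminf x \<le> (D - C) / t"
    if "t > 0" "\<And>m. 0 \<le> x m" "\<And>m. t * x m \<le> e m" for t and x :: "nat \<Rightarrow> real"
  proof -
    have le: "(\<Sum>m<N. x m) \<le> (D - C) / t" for N
    proof -
      have "t * (\<Sum>m<N. x m) \<le> (\<Sum>m<N. e m)"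
        unfolding sum_distrib_left by (intro sum_mono that)
      with e[of N] that(1) show ?thesis by (simp add: pos_le_divide_eq mult.commute)
    qed
    then have "summable x" using that(2) by (intro summableI_nonneg_bounded)
    with le show ?thesis by (auto intro: suminf_le_const)
  qed
  show "summable c" "suminf c \<le> (D - C) / (1 + 2 * D - C)"
    using *[of "1 + 2 * D - C" c] pos c0 c1 by auto
  show "summable (\<lambda>m. real (m + 2) * c m)" "(\<Sum>m. real (m + 2) * c m) \<le> 1"
    using *[of "D - C" "\<lambda>m. real (m + 2) * c m"] CD(2) c0 c2 by auto
qed

section \<open>Growth, injectivity and the distance to the boundary\<close>

lemma H0_rep_sums:
  assumes "H0_rep f h g a b" "z \<in> \<D>"
  shows "(\<lambda>m. a (m + 2) * z ^ (m + 2) + cnj (b (m + 2) * z ^ (m + 2))) sums (f z - z)"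
proof -
  have "(\<lambda>m. a (m + 2) * z ^ (m + 2)) sums (h z - z)" "(\<lambda>m. b (m + 2) * z ^ (m + 2)) sums g z"
    and "f z = h z + cnj (g z)"
    using assms unfolding H0_rep_def by blast+
  then show ?thesis
    using sums_add[of "\<lambda>m. a (m + 2) * z ^ (m + 2)" "h z - z" "\<lambda>m. cnj (b (m + 2) * z ^ (m + 2))" "cnj (g z)"]
    by (simp add: sums_cnj algebra_simps del: complex_cnj_mult)
qed

lemma H0_rep_continuous_on:
  assumes "H0_rep f h g a b"
  shows "continuous_on \<D> f"
proof -
  have "continuous_on \<D> h" "continuous_on \<D> g"
    using assms by (auto simp: H0_rep_def intro: holomorphic_on_imp_continuous_on)
  then have "continuous_on \<D> (\<lambda>z. h z + cnj (g z))"
    by (intro continuous_intros)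
  then show ?thesis
    by (rule continuous_on_eq) (use assms in \<open>simp add: H0_rep_def\<close>)
qed

text \<open>All exponents are at least 2, so each power is at most \<open>r\<^sup>2\<close>. Both
  the growth estimate and the bound for the Bohr sum rest on this.\<close>

lemma Bohr_tail_le:
  fixes c :: "nat \<Rightarrow> real"
  assumes "summable c" "\<And>m. 0 \<le> c m" "0 \<le> r" "r \<le> 1"
  shows "summable (\<lambda>m. c m * r ^ (m + 2))" "(\<Sum>m. c m * r ^ (m + 2)) \<le> suminf c * r\<^sup>2"
proof -
  have le: "c m * r ^ (m + 2) \<le> c m * r\<^sup>2" for m
    using assms by (intro mult_left_mono power_decreasing) auto
  have s: "summable (\<lambda>m. c m * r\<^sup>2)" using assms by (intro summable_mult2)
  show sm: "summable (\<lambda>m. c m * r ^ (m + 2))"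
    by (rule summable_comparison_test'[OF s, of 0]) (use le assms in \<open>auto simp: abs_mult\<close>)
  show "(\<Sum>m. c m * r ^ (m + 2)) \<le> suminf c * r\<^sup>2"
    unfolding suminf_mult2[OF assms(1)] by (rule suminf_le[OF le sm s])
qed

lemma H0_rep_norm_diff_le:
  assumes rep: "H0_rep f h g a b" and z: "z \<in> \<D>"
    and c: "summable (\<lambda>m. cmod (a (m + 2)) + cmod (b (m + 2)))"
      "(\<Sum>m. cmod (a (m + 2)) + cmod (b (m + 2))) \<le> k"
  shows "cmod (f z - z) \<le> k * (cmod z)\<^sup>2"
proof -
  note t = Bohr_tail_le[OF c(1), of "cmod z"]
  have "cmod (f z - z) = cmod (\<Sum>m. a (m + 2) * z ^ (m + 2) + cnj (b (m + 2) * z ^ (m + 2)))"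
    using H0_rep_sums[OF rep z] by (simp add: sums_iff)
  also have "\<dots> \<le> (\<Sum>m. (cmod (a (m + 2)) + cmod (b (m + 2))) * cmod z ^ (m + 2))"
  proof (rule norm_suminf_le)
    show "cmod (a (m + 2) * z ^ (m + 2) + cnj (b (m + 2) * z ^ (m + 2)))
        \<le> (cmod (a (m + 2)) + cmod (b (m + 2))) * cmod z ^ (m + 2)" for m
      by (rule order_trans[OF norm_triangle_ineq]) (simp add: norm_mult norm_power algebra_simps)
  qed (use t z in auto)
  also have "\<dots> \<le> (\<Sum>m. cmod (a (m + 2)) + cmod (b (m + 2))) * (cmod z)\<^sup>2"
    using t z by auto
  also have "\<dots> \<le> k * (cmod z)\<^sup>2" using c(2) by (intro mult_right_mono) auto
  finally show ?thesis .
qed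

text \<open>Scaling by \<open>\<rho>\<close> reduces this to the unit disc, where the n-th power has
  Lipschitz constant \<open>n\<close>. The factor \<open>\<rho>\<close> on the left avoids the
  exponent \<open>n - 1\<close>.\<close>

lemma norm_power_diff_scaled:
  fixes z w :: complex
  assumes "cmod z \<le> \<rho>" "cmod w \<le> \<rho>" "0 < \<rho>"
  shows "cmod (z ^ n - w ^ n) * \<rho> \<le> real n * \<rho> ^ n * cmod (z - w)"
proof -
  have "cmod ((z / \<rho>) ^ n - (w / \<rho>) ^ n) \<le> n * cmod (z / \<rho> - w / \<rho>)"
    using assms by (intro norm_power_diff) (auto simp: norm_divide)
  moreover have "(z / \<rho>) ^ n - (w / \<rho>) ^ n = (z ^ n - w ^ n) / of_real (\<rho> ^ n)"
    by (simp add: power_divide diff_divide_distrib)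
  moreover have "z / \<rho> - w / \<rho> = (z - w) / of_real \<rho>"
    by (simp add: diff_divide_distrib)
  ultimately have "cmod (z ^ n - w ^ n) / \<rho> ^ n \<le> n * (cmod (z - w) / \<rho>)"
    using assms by (simp add: norm_divide norm_power)
  then show ?thesis using assms by (simp add: field_simps)
qed

text \<open>The nonlinear part of \<open>f\<close> is a strict contraction on each smaller disc.\<close>

lemma H0_rep_inj_on:
  assumes rep: "H0_rep f h g a b"
  defines "c \<equiv> \<lambda>m. cmod (a (m + 2)) + cmod (b (m + 2))"
  assumes c: "summable (\<lambda>m. real (m + 2) * c m)" "(\<Sum>m. real (m + 2) * c m) \<le> 1"
  shows "inj_on f \<D>"
proof (rule inj_onI, rule ccontr)
  fix z w assume z: "z \<in> \<D>" and w: "w \<in> \<D>" and eq: "f z = f w" and ne: "z \<noteq> w"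
  define \<rho> where "\<rho> = max (cmod z) (cmod w)"
  have \<rho>: "0 < \<rho>" "\<rho> < 1" "cmod z \<le> \<rho>" "cmod w \<le> \<rho>"
    using z w ne by (auto simp: \<rho>_def less_max_iff_disj)
  define d where "d = cmod (z - w)"
  have d: "d > 0" using ne by (simp add: d_def)
  define s where "s m = (a (m + 2) * z ^ (m + 2) + cnj (b (m + 2) * z ^ (m + 2)))
      - (a (m + 2) * w ^ (m + 2) + cnj (b (m + 2) * w ^ (m + 2)))" for m
  \<comment> \<open>As \<open>f z = f w\<close>, the nonlinear parts differ by \<open>w - z\<close>,
    of modulus \<open>d\<close>, while the termwise estimate gives at most
    \<open>\<rho> * d\<close>. The factor \<open>\<rho>\<close> makes this strict even when the
    weighted sum equals 1.\<close>
  have "s sums ((f z - z) - (f w - w))"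
    unfolding s_def by (intro sums_diff H0_rep_sums[OF rep] z w)
  then have "cmod (suminf s) = d"
    using eq by (simp add: sums_iff d_def norm_minus_commute)
  moreover have "cmod (suminf s) \<le> (\<Sum>m. real (m + 2) * c m * (\<rho> * d))"
  proof (rule norm_suminf_le)
    fix m
    define p where "p = z ^ (m + 2) - w ^ (m + 2)"
    have "s m = a (m + 2) * p + cnj (b (m + 2) * p)"
      by (simp add: s_def p_def algebra_simps)
    then have "cmod (s m) \<le> cmod (a (m + 2) * p) + cmod (cnj (b (m + 2) * p))"
      using norm_triangle_ineq by metis
    also have "\<dots> = c m * cmod p"
      unfolding complex_mod_cnj norm_mult c_def by (simp add: algebra_simps)
    also have "\<dots> \<le> c m * (real (m + 2) * \<rho> * d)"
    proof (rule mult_left_mono)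
      have "cmod p * \<rho> \<le> (real (m + 2) * \<rho> ^ (m + 1) * d) * \<rho>"
        using norm_power_diff_scaled[OF \<rho>(3,4,1), of "m + 2"] by (simp add: p_def d_def algebra_simps)
      then have "cmod p \<le> real (m + 2) * \<rho> ^ (m + 1) * d" using \<rho>(1) by (simp add: mult_ac)
      also have "\<dots> \<le> real (m + 2) * \<rho> ^ 1 * d"
        using \<rho> d by (intro mult_right_mono mult_left_mono power_decreasing) auto
      finally show "cmod p \<le> real (m + 2) * \<rho> * d" by simp
    qed (simp add: c_def)
    finally show "cmod (s m) \<le> real (m + 2) * c m * (\<rho> * d)" by (simp add: algebra_simps)
  qed (use c in \<open>intro summable_mult2\<close>)
  moreover have "(\<Sum>m. real (m + 2) * c m * (\<rho> * d)) = (\<Sum>m. real (m + 2) * c m) * (\<rho> * d)"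
    using c(1) by (rule suminf_mult2[symmetric])
  moreover have "\<dots> \<le> 1 * (\<rho> * d)" using c(2) \<rho> d by (intro mult_right_mono) auto
  moreover have "\<rho> * d < 1 * d" using \<rho> d by (intro mult_strict_right_mono)
  ultimately show False by linarith
qed

lemma H0_rep_boundary_dist_ge:
  assumes rep: "H0_rep f h g a b" and inj: "inj_on f \<D>" and k: "0 \<le> k"
    and near: "\<And>z. z \<in> \<D> \<Longrightarrow> cmod (f z - z) \<le> k * (cmod z)\<^sup>2"
  shows "1 - k \<le> boundary_dist f"
proof -
  have cont: "continuous_on \<D> f" using rep by (rule H0_rep_continuous_on)
  have op: "open (f ` \<D>)" using invariance_of_domain[OF cont open_ball inj] .
  have growth: "cmod z - k \<le> cmod (f z)" "cmod (f z) \<le> 1 + k" if "z \<in> \<D>" for z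
  proof -
    have "k * (cmod z)\<^sup>2 \<le> k * 1" using k that by (intro mult_left_mono) (auto simp: power_le_one)
    then show "cmod z - k \<le> cmod (f z)" "cmod (f z) \<le> 1 + k"
      using near[OF that] that norm_triangle_ineq2[of z "f z"] norm_triangle_ineq2[of "f z" z]
      by (auto simp: norm_minus_commute)
  qed
  \<comment> \<open>The frontier must be nonempty, because \<open>infdist\<close> to the empty set
    is 0 by convention. The value \<open>2 + k\<close> is beyond the bound
    \<open>1 + k\<close>.\<close>
  have "f ` \<D> \<noteq> UNIV"
  proof
    assume "f ` \<D> = UNIV"
    then obtain z where "z \<in> \<D>" "f z = of_real (2 + k)" by (metis UNIV_I imageE)
    with growth(2)[of z] k show False
      unfolding norm_of_real by (simp del: of_real_add)
  qed
  then have ne: "frontier (f ` \<D>) \<noteq> {}" by (intro frontier_not_empty) auto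
  have "1 - k \<le> cmod w" if w: "w \<in> frontier (f ` \<D>)" for w
  proof -
    have w1: "w \<in> closure (f ` \<D>)" "w \<notin> f ` \<D>"
      using w op by (auto simp: frontier_def interior_open)
    have "\<rho> - k \<le> cmod w" if \<rho>: "\<rho> < 1" for \<rho>
    proof -
      \<comment> \<open>The image of the smaller closed disc is closed and avoids \<open>w\<close>;
        all other values of \<open>f\<close> have modulus at least \<open>\<rho> - k\<close>, and
        this passes to the closure.\<close>
      have "closed (f ` cball 0 \<rho>)"
        using \<rho> by (intro compact_imp_closed compact_continuous_image continuous_on_subset[OF cont]) auto
      moreover have "f ` \<D> \<subseteq> f ` cball 0 \<rho> \<union> - ball 0 (\<rho> - k)"
        using growth(1) by force
      ultimately have "closure (f ` \<D>) \<subseteq> f ` cball 0 \<rho> \<union> - ball 0 (\<rho> - k)"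
        by (intro closure_minimal closed_Un) auto
      moreover have "w \<notin> f ` cball 0 \<rho>" using w1(2) \<rho> by auto
      ultimately show ?thesis using w1(1) by (auto simp: subset_iff)
    qed
    then show ?thesis
      using dense_le[of 1 "cmod w + k"] by (simp add: algebra_simps)
  qed
  then show ?thesis
    unfolding boundary_dist_def infdist_def H0_rep_at_0(3)[OF rep]
    using ne by (auto intro!: cINF_greatest)
qed

lemma Bohr_sum_le:
  assumes c: "summable (\<lambda>m. cmod (a (m + 2)) + cmod (b (m + 2)))"
      "(\<Sum>m. cmod (a (m + 2)) + cmod (b (m + 2))) \<le> k" and z: "cmod z \<le> 1"
  shows "Bohr_sum a b z \<le> cmod z + k * (cmod z)\<^sup>2"
  using Bohr_tail_le(2)[OF c(1), of "cmod z"] mult_right_mono[OF c(2), of "(cmod z)\<^sup>2"] z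
  by (simp add: Bohr_sum_def)

section \<open>The extremal function\<close>

lemma quadratic_H0_rep:
  "H0_rep (\<lambda>z. z - of_real k * z ^ 2) (\<lambda>z. z - of_real k * z ^ 2) (\<lambda>_. 0)
     (\<lambda>m. if m = 2 then - of_real k else 0) (\<lambda>_. 0)"
proof -
  have "(\<lambda>m. (if m + 2 = 2 then - of_real k else 0) * z ^ (m + 2)) sums (- of_real k * z\<^sup>2)" for z :: complex
    using sums_finite[of "{0::nat}" "\<lambda>m. (if m + 2 = 2 then - of_real k else 0) * z ^ (m + 2)"]
    by (simp add: power2_eq_square)
  then show ?thesis by (auto simp: H0_rep_def intro!: holomorphic_intros)
qed

lemma quadratic_Bohr_sum:
  assumes rep: "H0_rep (\<lambda>z. z - of_real k * z ^ 2) h g a b" and k: "0 \<le> k"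
  shows "Bohr_sum a b z = cmod z + k * (cmod z)\<^sup>2"
proof -
  have "(\<lambda>m. (cmod (a (m + 2)) + cmod (b (m + 2))) * cmod z ^ (m + 2)) = (\<lambda>m. if m = 0 then k * (cmod z)\<^sup>2 else 0)"
    using H0_rep_unique[OF rep quadratic_H0_rep] k by (auto simp: power2_eq_square)
  then show ?thesis
    using sums_unique[OF sums_If_finite_set[of "{0::nat}" "\<lambda>_. k * (cmod z)\<^sup>2"]] by (simp add: Bohr_sum_def)
qed

lemma quadratic_in_Sstar_tau:
  fixes C D :: real
  assumes CD: "- D \<le> C" "C < D" "D \<le> 1" and k: "k = (D - C) / (1 + 2 * D - C)"
  shows "(\<lambda>z. z - of_real k * z ^ 2) \<in> Sstar_tau C D"
proof -
  define f where "f z = z - of_real k * z ^ 2" for z :: complex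
  have D: "0 < D" using CD by linarith
  have pos: "0 < 1 + 2 * D - C" using CD D by linarith
  have k01: "0 < k" "k < 1" and kD: "k * (1 + 2 * D - C) = D - C"
    using CD D pos unfolding k by simp_all
  have f_eq: "f z = z * (1 - k * z)" for z :: complex by (simp add: f_def algebra_simps power2_eq_square)
  have ne1: "1 - k * z \<noteq> 0" if "z \<in> \<D>" for z :: complex
  proof
    assume "1 - k * z = 0"
    then have "of_real k * z = 1" by (metis right_minus_eq)
    then have "cmod (k * z) = 1" by (metis norm_one)
    moreover have "k * cmod z < 1 * 1" using that k01 by (intro mult_strict_mono) auto
    ultimately show False using k01 by (simp add: norm_mult)
  qed
  have dh: "deriv f z = 1 - 2 * k * z" for z :: complex
    unfolding f_def by (rule DERIV_imp_deriv) (auto intro!: derivative_eq_intros simp: algebra_simps)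
  have rep: "H0_rep f f (\<lambda>_. 0) (\<lambda>m. if m = 2 then - of_real k else 0) (\<lambda>_. 0)"
    using quadratic_H0_rep[of k] unfolding f_def .
  have tau: "f \<in> tau0"
    unfolding tau0_def
    by (rule CollectI, rule exI, rule exI, rule exI, rule exI, rule conjI, rule rep) (use k01 in auto)
  have quot: "D_H f (\<lambda>_. 0) z / f z = (1 - 2 * k * z) / (1 - k * z)" if "z \<noteq> 0" for z :: complex
    using that by (simp add: D_H_def dh f_eq)
  have range: "\<exists>\<zeta>\<in>\<D>. (1 - 2 * k * z) / (1 - k * z) = (1 + of_real C * \<zeta>) / (1 + of_real D * \<zeta>)"
    if z: "z \<in> \<D>" for z :: complex
  proof -
    \<comment> \<open>Solving \<open>(1 - 2kz) / (1 - kz) = (1 + C\<zeta>) / (1 + D\<zeta>)\<close>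
      for \<open>\<zeta>\<close> gives \<open>kz / w\<close>. The choice of \<open>k\<close> turns
      the estimate for \<open>cmod \<zeta> < 1\<close> into \<open>cmod z < 1\<close>.\<close>
    define w where "w = of_real (D - C) - of_real ((2 * D - C) * k) * z"
    have "k * cmod z + (2 * D - C) * k * cmod z < D - C"
    proof -
      have "k * cmod z + (2 * D - C) * k * cmod z = k * (1 + 2 * D - C) * cmod z"
        by (simp add: algebra_simps)
      also have "\<dots> < (D - C) * 1" unfolding kD using CD z by (intro mult_strict_left_mono) auto
      finally show ?thesis by simp
    qed
    moreover have "cmod w \<ge> (D - C) - (2 * D - C) * k * cmod z"
      unfolding w_def using CD D k01
      by (intro order_trans[OF _ norm_triangle_ineq2]) (simp add: norm_mult del: of_real_diff of_real_mult)
    ultimately have w: "k * cmod z < cmod w" by linarith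
    moreover have "0 \<le> k * cmod z" using k01 by simp
    ultimately have w0: "w \<noteq> 0" by fastforce
    define \<zeta> where "\<zeta> = k * z / w"
    have \<zeta>: "cmod \<zeta> < 1" using w w0 k01 by (simp add: \<zeta>_def norm_divide norm_mult)
    have "D * cmod \<zeta> \<le> 1 * cmod \<zeta>" using CD by (intro mult_right_mono) auto
    then have "cmod (of_real D * \<zeta>) < 1" using \<zeta> D by (simp add: norm_mult)
    then have ne2: "1 + of_real D * \<zeta> \<noteq> 0"
      by (metis add.inverse_inverse add_eq_0_iff norm_minus_cancel norm_one order_less_irrefl)
    have "\<zeta> * w = k * z" using w0 by (simp add: \<zeta>_def)
    then have \<zeta>w: "(1 + x * \<zeta>) * w = w + x * (k * z)" for x
      by (simp add: algebra_simps)
    \<comment> \<open>Multiplication by \<open>w\<close> turns both parts of the Moebius quotient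
      into \<open>D - C\<close> times those of the quotient for \<open>f\<close>.\<close>
    have "(1 + of_real D * \<zeta>) * w = of_real (D - C) * (1 - k * z)"
      "(1 + of_real C * \<zeta>) * w = of_real (D - C) * (1 - 2 * k * z)"
      unfolding \<zeta>w by (simp_all add: w_def algebra_simps)
    then have "(1 - 2 * k * z) * (1 + of_real D * \<zeta>) * (w * of_real (D - C)) =
        (1 + of_real C * \<zeta>) * (1 - k * z) * (w * of_real (D - C))"
      by algebra
    then have "(1 - 2 * k * z) * (1 + of_real D * \<zeta>) = (1 + of_real C * \<zeta>) * (1 - k * z)"
      using w0 CD by simp
    then show ?thesis
      using \<zeta> ne1[OF z] ne2 by (intro bexI[of _ \<zeta>]) (auto simp: frac_eq_eq)
  qed
  have "(\<lambda>z. if z = 0 then 1 else D_H f (\<lambda>_. 0) z / f z) = (\<lambda>z::complex. (1 - 2 * k * z) / (1 - k * z))"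
    by (rule ext) (simp add: quot)
  then have "(\<lambda>z. if z = 0 then 1 else D_H f (\<lambda>_. 0) z / f z)
       \<prec>\<^sub>D (\<lambda>z. (1 + of_real C * z) / (1 + of_real D * z))"
    using range by (simp add: subordinate_def image_subset_iff image_iff)
  moreover have "\<forall>z\<in>\<D> - {0}. f z \<noteq> 0" using ne1 by (auto simp: f_eq)
  ultimately have "f \<in> Sstar_H C D"
    unfolding Sstar_H_def using rep by blast
  with tau have "f \<in> Sstar_tau C D" by (simp add: Sstar_tau_def)
  then show ?thesis unfolding f_def .
qed

text \<open>The point \<open>f 1 = 1 - k\<close> lies on the frontier: it is a limit of values on
  the disc, but not a value there.\<close>

lemma quadratic_boundary_dist_le:
  assumes k: "0 < k" "k \<le> 1 / 2"
  shows "boundary_dist (\<lambda>z. z - of_real k * z ^ 2) \<le> 1 - k"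
proof -
  define f where "f z = z - of_real k * z ^ 2" for z :: complex
  have "f 1 \<in> f ` closure \<D>" by simp
  moreover have "f ` closure \<D> \<subseteq> closure (f ` \<D>)"
    by (rule image_closure_subset) (auto simp: f_def closure_subset intro!: continuous_intros)
  ultimately have "f 1 \<in> closure (f ` \<D>)" by blast
  moreover have "f 1 \<notin> f ` \<D>"
  proof
    assume "f 1 \<in> f ` \<D>"
    then obtain z where z: "z \<in> \<D>" "f z = f 1" by auto
    \<comment> \<open>The other root \<open>(1 - k) / k\<close> has modulus at least 1 because
      \<open>k\<close> is at most one half.\<close>
    then have "(z - 1) * (k * z - (1 - k)) = 0" by (simp add: f_def algebra_simps power2_eq_square)
    moreover have "z \<noteq> 1" using z by auto
    ultimately have "k * z = of_real (1 - k)" by simp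
    then have "cmod (k * z) = cmod (of_real (1 - k))" by simp
    then have "k * cmod z = 1 - k" unfolding norm_mult norm_of_real using k by simp
    moreover have "k * cmod z < k * 1" using z k by (intro mult_strict_left_mono) auto
    ultimately show False using k by simp
  qed
  ultimately have "f 1 \<in> frontier (f ` \<D>)"
    using interior_subset by (auto simp: frontier_def)
  then have "infdist (f 0) (frontier (f ` \<D>)) \<le> dist (f 0) (f 1)" by (rule infdist_le)
  also have "f 0 = 0" by (simp add: f_def)
  also have "f 1 = of_real (1 - k)" by (simp add: f_def)
  also have "dist 0 (complex_of_real (1 - k)) = 1 - k" unfolding dist_0_norm norm_of_real using k by simp
  finally show ?thesis by (simp add: boundary_dist_def f_def)
qed

section \<open>The Bohr radius and its sharpness\<close>

lemma Bohr_root: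
  fixes k R :: real
  assumes k: "0 < k" "k < 1" and R: "R = (- 1 + sqrt (1 + 4 * k * (1 - k))) / (2 * k)"
  shows "0 < R" "R < 1" "R + k * R\<^sup>2 = 1 - k"
proof -
  define s where "s = sqrt (1 + 4 * k * (1 - k))"
  have p: "0 < 4 * k * (1 - k)" using k by simp
  have s2: "s\<^sup>2 = 1 + 4 * k * (1 - k)" using p by (simp add: s_def)
  have "1 < s" using p by (simp add: s_def)
  \<comment> \<open>This amounts to \<open>R < 1\<close>; the squares differ by
    \<open>8 * k\<^sup>2\<close>.\<close>
  have "s < 1 + 2 * k"
    unfolding s_def using k by (intro real_less_lsqrt) (auto simp: power2_eq_square algebra_simps)
  have R': "2 * k * R = s - 1" using k by (simp add: R s_def)
  show "0 < R" "R < 1" using k \<open>1 < s\<close> \<open>s < 1 + 2 * k\<close> unfolding R s_def[symmetric] by simp_all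
  have "4 * k * (R + k * R\<^sup>2) = (2 * k * R)\<^sup>2 + 2 * (2 * k * R)"
    by (simp add: power2_eq_square algebra_simps)
  also have "\<dots> = 4 * k * (1 - k)" unfolding R' using s2 by (simp add: power2_eq_square algebra_simps)
  finally show "R + k * R\<^sup>2 = 1 - k" using k by simp
qed

text \<open>For maximality it suffices that one member violates the inequality at every point of the
  positive radius beyond \<open>R\<close>.\<close>

lemma is_Bohr_radiusI:
  assumes F: "f0 \<in> F" and rep: "H0_rep f0 h g a b" and R: "0 \<le> R" "R \<le> 1"
    and le: "\<And>f h g a b z. f \<in> F \<Longrightarrow> H0_rep f h g a b \<Longrightarrow> cmod z \<le> R \<Longrightarrow> cmod z < 1 \<Longrightarrow>
        Bohr_sum a b z \<le> boundary_dist f"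
    and gt: "\<And>x. R < x \<Longrightarrow> x < 1 \<Longrightarrow> boundary_dist f0 < Bohr_sum a b (of_real x)"
  shows "is_Bohr_radius F R"
  unfolding is_Bohr_radius_def
proof (intro conjI ballI)
  show "R \<in> Bohr_radii F" using R le by (auto simp: Bohr_radii_def)
next
  fix R' assume R': "R' \<in> Bohr_radii F"
  show "R' \<le> R"
  proof (rule ccontr)
    assume "\<not> R' \<le> R"
    \<comment> \<open>The midpoint lies inside the disc even when \<open>R' = 1\<close>.\<close>
    define x where "x = (R + R') / 2"
    have x: "R < x" "x < R'" "0 \<le> x" "x < 1"
      using \<open>\<not> R' \<le> R\<close> R' R by (auto simp: x_def Bohr_radii_def)
    then have "Bohr_sum a b (of_real x) \<le> boundary_dist f0"
      using R' F rep unfolding Bohr_radii_def by auto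
    with gt[of x] x show False by simp
  qed
qed

theorem theorem2p5:
  fixes C D k rstar :: real and f0 :: "complex \<Rightarrow> complex"
  assumes "- D \<le> C" and "C < D" and "D \<le> 1"
    and k: "k = (D - C) / (1 + 2 * D - C)"
    and rstar: "rstar = (- 1 + sqrt (1 + 4 * k * (1 - k))) / (2 * k)"
    and f0: "f0 = (\<lambda>z. z - of_real k * z ^ 2)"
  shows
    "(\<forall>f\<in>Sstar_tau C D. \<forall>h g a b. H0_rep f h g a b \<longrightarrow>
        (\<forall>z r. cmod z = r \<and> r < 1 \<longrightarrow>
           r - k * r ^ 2 \<le> cmod (f z) \<and> cmod (f z) \<le> r + k * r ^ 2) \<and>
        (\<forall>z. cmod z \<le> rstar \<longrightarrow> Bohr_sum a b z \<le> boundary_dist f)) \<and>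
     is_Bohr_radius (Sstar_tau C D) rstar \<and>
     f0 \<in> Sstar_tau C D \<and>
     is_Bohr_radius {f0} rstar \<and>
     (\<forall>h g a b. H0_rep f0 h g a b \<longrightarrow>
        (\<forall>z. cmod z = rstar \<longrightarrow> Bohr_sum a b z = boundary_dist f0))"
proof -
  note CD = assms(1-3)
  \<comment> \<open>The bound by one half is equivalent to \<open>C\<close> being at least
    -1.\<close>
  have k0: "0 < k" "k \<le> 1 / 2" "k < 1"
    using CD by (auto simp: k field_simps)
  note bounds = Sstar_tau_coeff_bounds[OF _ _ CD, folded k]
  note root = Bohr_root[OF k0(1,3) rstar]
  have mono: "x + k * x\<^sup>2 \<le> y + k * y\<^sup>2" if "0 \<le> x" "x \<le> y" for x y
    using that k0 by (intro add_mono mult_left_mono power_mono) auto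
  have near: "cmod (f z - z) \<le> k * (cmod z)\<^sup>2"
    if "f \<in> Sstar_tau C D" "H0_rep f h g a b" "z \<in> \<D>" for f h g a b z
    by (rule H0_rep_norm_diff_le[OF that(2,3) bounds(1,2)[OF that(1,2)]])
  have dist: "1 - k \<le> boundary_dist f"
    if "f \<in> Sstar_tau C D" "H0_rep f h g a b" for f h g a b
    by (rule H0_rep_boundary_dist_ge[OF that(2) H0_rep_inj_on[OF that(2) bounds(3,4)[OF that]]])
      (use near[OF that] k0 in auto)
  have Bohr: "Bohr_sum a b z \<le> boundary_dist f"
    if "f \<in> Sstar_tau C D" "H0_rep f h g a b" "cmod z \<le> rstar" for f h g a b z
  proof -
    have "Bohr_sum a b z \<le> cmod z + k * (cmod z)\<^sup>2"
      by (rule Bohr_sum_le[OF bounds(1,2)[OF that(1,2)]]) (use that(3) root(2) in simp)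
    also have "\<dots> \<le> 1 - k" using mono[of "cmod z" rstar] that(3) root(3) by simp
    also have "\<dots> \<le> boundary_dist f" using dist[OF that(1,2)] .
    finally show ?thesis .
  qed
  have f0_mem: "f0 \<in> Sstar_tau C D" unfolding f0 by (rule quadratic_in_Sstar_tau[OF CD k])
  have f0_rep: "H0_rep f0 f0 (\<lambda>_. 0) (\<lambda>m. if m = 2 then - of_real k else 0) (\<lambda>_. 0)"
    unfolding f0 by (rule quadratic_H0_rep)
  have f0_sum: "Bohr_sum a b z = cmod z + k * (cmod z)\<^sup>2" if "H0_rep f0 h g a b" for h g a b z
    using quadratic_Bohr_sum[of k h g a b z] that k0 by (simp add: f0)
  have f0_dist: "boundary_dist f0 = 1 - k"
    using dist[OF f0_mem f0_rep] quadratic_boundary_dist_le[OF k0(1,2)] by (simp add: f0)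
  have gt: "boundary_dist f0 < Bohr_sum (\<lambda>m. if m = 2 then - of_real k else 0) (\<lambda>_. 0) (of_real x)"
    if "rstar < x" for x
  proof -
    have "k * rstar\<^sup>2 \<le> k * x\<^sup>2" using that root(1) k0 by (intro mult_left_mono power_mono) auto
    then show ?thesis using that root by (simp add: f0_dist f0_sum[OF f0_rep])
  qed
  \<comment> \<open>Any family between \<open>{f0}\<close> and the whole class has the same radius;
    both extremes are required.\<close>
  have "is_Bohr_radius F rstar" if "f0 \<in> F" "F \<subseteq> Sstar_tau C D" for F
    using is_Bohr_radiusI[OF that(1) f0_rep, of rstar] Bohr gt root(1,2) that(2) by (force simp: less_imp_le)
  moreover have "r - k * r ^ 2 \<le> cmod (f z) \<and> cmod (f z) \<le> r + k * r ^ 2"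
    if "f \<in> Sstar_tau C D" "H0_rep f h g a b" "cmod z = r" "r < 1" for f h g a b z r
    using near[OF that(1,2), of z] that(3,4) norm_triangle_ineq2[of z "f z"] norm_triangle_ineq2[of "f z" z]
    by (auto simp: norm_minus_commute)
  ultimately show ?thesis
    using Bohr f0_mem f0_sum f0_dist root(3) by auto
qed

end
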